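(* Let $\mathcal L=\sum_e\mathcal L_e$ be a $k$-local Lindblad generator on $n$ qubits with weighted interaction strength $\alpha$. For $q\in\mathbb N\setminus\{0\}$, let $Q$ be an arbitrary $q$-local operator and let $a=\lceil q/k\rceil$. Then, for any error $\varepsilon\in(0,1)$ and time $t\in[0,(4\alpha k)^{-1}]$, the operator-valued polynomial $$Q^{(d)}(t):=\sum_{m=0}^d\frac{t^m}{m!}(\mathcal L^\dagger)^m(Q)$$ of degree $d:=a+\lceil\log_2\frac1\varepsilon\rceil=\mathcal O(a+\log\frac1\varepsilon)$ satisfies $$\bigl\|e^{t\mathcal L^\dagger}[Q]-Q^{(d)}(t)\bigr\|_2\le\varepsilon\,\|Q\|_2 .$$
   Context: A $q$-local operator on $(\mathbb C^2)^{\otimes n}$ is one supported on (acting nontrivially on) at most $q$ qubits. $\|X\|_2=\operatorname{Tr}[X^\dagger X]^{1/2}$ and $\|\cdot\|_{2\to2}$ is the induced norm on superoperators; $\mathcal L^\dagger$ is the adjoint with respect to the Hilbert--Schmidt inner product (Heisenberg picture). A $k$-local Lindblad generator is $\mathcal L=\sum_{e\subseteq[n],|e|\le k}\mathcal L_e$, where each $\mathcal L_e$ is a Lindblad (GKSL) generator (Hamiltonian part and dissipation) acting nontrivially only on the qubits in $e$. The weighted interaction strength is $\alpha=\max_{u\in[n]}\sum_{e\ni u}\|\mathcal L_e^\dagger\|_{2\to2}$. *)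

theory Defs
  imports "HOL-Analysis.Analysis" "HOL-Library.Landau_Symbols"
begin

(* The qubits are the elements of a finite type 'n, computational basis states are
   bit strings 'n \<Rightarrow> bool, and operators are matrices in that basis. *)
type_synonym 'n op = "complex ^ ('n \<Rightarrow> bool) ^ ('n \<Rightarrow> bool)"
type_synonym 'n superop = "'n op \<Rightarrow> 'n op"

definition dagger :: "('n::finite) op \<Rightarrow> 'n op" where
  "dagger A = (\<chi> x y. cnj (A $ y $ x))"

definition cscale :: "complex \<Rightarrow> ('n::finite) op \<Rightarrow> 'n op" where
  "cscale c A = (\<chi> x y. c * A $ x $ y)"

definition hs_inner :: "('n::finite) op \<Rightarrow> 'n op \<Rightarrow> complex" where
  "hs_inner X Y = trace (dagger X ** Y)"

definition hs_norm :: "('n::finite) op \<Rightarrow> real" where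
  "hs_norm X = sqrt (Re (trace (dagger X ** X)))"

definition superop_norm :: "('n::finite) superop \<Rightarrow> real" where
  "superop_norm F = (SUP X\<in>{X. X \<noteq> 0}. hs_norm (F X) / hs_norm X)"

definition hs_adjoint :: "('n::finite) superop \<Rightarrow> 'n superop" where
  "hs_adjoint F = (THE G. \<forall>X Y. hs_inner X (F Y) = hs_inner (G X) Y)"

definition superop_exp :: "('n::finite) superop \<Rightarrow> 'n superop" where
  "superop_exp F X = (\<Sum>m. (1 / fact m) *\<^sub>R (F ^^ m) X)"

(* A is of the form B \<otimes> 1, with B acting on the qubits in S and the
   identity acting on the remaining ones. *)
definition supported_on :: "('n::finite) set \<Rightarrow> 'n op \<Rightarrow> bool" where
  "supported_on S A \<longleftrightarrow> (\<exists>B :: ('n \<Rightarrow> bool) \<Rightarrow> ('n \<Rightarrow> bool) \<Rightarrow> complex. \<forall>x y.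
     A $ x $ y = (if restrict x (- S) = restrict y (- S)
                  then B (restrict x S) (restrict y S) else 0))"

definition local_op :: "nat \<Rightarrow> ('n::finite) op \<Rightarrow> bool" where
  "local_op q A \<longleftrightarrow> (\<exists>S. card S \<le> q \<and> supported_on S A)"

(* The dissipation rates are absorbed into the jump operators Js. *)
definition gksl :: "('n::finite) op \<Rightarrow> 'n op list \<Rightarrow> 'n superop" where
  "gksl H Js \<rho> = cscale (- \<i>) (H ** \<rho> - \<rho> ** H)
     + (\<Sum>J\<leftarrow>Js. J ** \<rho> ** dagger J
          - (1 / 2) *\<^sub>R (dagger J ** J ** \<rho> + \<rho> ** (dagger J ** J)))"

(* A Lindblad generator on the qubits in e, tensored with the identity superoperator
   on the others: both the Hamiltonian and the jump operators act on e only. *)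
definition lindblad_on :: "('n::finite) set \<Rightarrow> 'n superop \<Rightarrow> bool" where
  "lindblad_on e F \<longleftrightarrow> (\<exists>H Js. dagger H = H \<and> supported_on e H \<and>
     (\<forall>J\<in>set Js. supported_on e J) \<and> F = gksl H Js)"

definition local_lindblad :: "nat \<Rightarrow> (('n::finite) set \<Rightarrow> 'n superop) \<Rightarrow> 'n superop \<Rightarrow> bool" where
  "local_lindblad k Le L \<longleftrightarrow> (\<forall>e. card e \<le> k \<longrightarrow> lindblad_on e (Le e)) \<and>
     L = (\<lambda>X. \<Sum>e | card e \<le> k. Le e X)"

definition interaction_strength :: "nat \<Rightarrow> (('n::finite) set \<Rightarrow> 'n superop) \<Rightarrow> real" where
  "interaction_strength k Le =
     (MAX u. \<Sum>e | card e \<le> k \<and> u \<in> e. superop_norm (hs_adjoint (Le e)))"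

definition truncation_degree :: "nat \<Rightarrow> real \<Rightarrow> nat" where
  "truncation_degree a \<epsilon> = a + nat \<lceil>log 2 (1 / \<epsilon>)\<rceil>"

definition taylor_op :: "('n::finite) superop \<Rightarrow> 'n op \<Rightarrow> nat \<Rightarrow> real \<Rightarrow> 'n op" where
  "taylor_op F Q d t = (\<Sum>m\<le>d. (t ^ m / fact m) *\<^sub>R (F ^^ m) Q)"

text \<open>The Hilbert-Schmidt norm is the library norm of matrices, and the three notions above
  that rest on \<open>THE\<close>, \<open>SUP\<close> and an infinite series are well defined.\<close>

lemma hs_inner_sum: "hs_inner X Y = (\<Sum>x\<in>UNIV. \<Sum>y\<in>UNIV. cnj (X $ x $ y) * Y $ x $ y)"
proof -
  have "hs_inner X Y = (\<Sum>y\<in>UNIV. \<Sum>x\<in>UNIV. cnj (X $ x $ y) * Y $ x $ y)"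
    by (simp add: hs_inner_def trace_def dagger_def matrix_matrix_mult_def)
  also have "\<dots> = (\<Sum>x\<in>UNIV. \<Sum>y\<in>UNIV. cnj (X $ x $ y) * Y $ x $ y)" by (rule sum.swap)
  finally show ?thesis .
qed

lemma hs_norm_eq_norm: "hs_norm X = norm X"
proof -
  have "Re (hs_inner X X) = (\<Sum>x\<in>UNIV. \<Sum>y\<in>UNIV. (norm (X $ x $ y))\<^sup>2)"
    unfolding hs_inner_sum by (simp add: cmod_power2 flip: power2_eq_square)
  also have "\<dots> = (norm X)\<^sup>2"
    by (simp add: norm_vec_def L2_set_def sum_nonneg)
  finally show ?thesis by (simp add: hs_norm_def hs_inner_def)
qed

lemma superop_norm_eq_onorm:
  fixes F :: "('n::finite) superop"
  assumes "linear F"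
  shows "superop_norm F = onorm F"
proof -
  have bl: "bounded_linear F" using assms by (simp add: linear_conv_bounded_linear)
  have bdd: "bdd_above (range (\<lambda>X. norm (F X) / norm X))"
    by (rule bdd_aboveI2[where M = "onorm F"]) (rule le_onorm[OF bl])
  have ne: "{X :: 'n op. X \<noteq> 0} \<noteq> {}"
  proof -
    have "(\<chi> x y. (1 :: complex)) \<noteq> (0 :: 'n op)" by (simp add: vec_eq_iff)
    then show ?thesis by blast
  qed
  have b2: "bdd_above ((\<lambda>X. norm (F X) / norm X) ` {X. X \<noteq> 0})"
    by (rule bdd_above_mono[OF bdd]) auto
  have "(SUP X\<in>{X. X \<noteq> 0}. norm (F X) / norm X) = (SUP X. norm (F X) / norm X)"
  proof (rule antisym)
    show "(SUP X\<in>{X. X \<noteq> 0}. norm (F X) / norm X) \<le> (SUP X. norm (F X) / norm X)"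
      by (rule cSUP_subset_mono) (use ne bdd in auto)
    obtain Z :: "'n op" where "Z \<noteq> 0" using ne by auto
    then have nn: "0 \<le> (SUP X\<in>{X. X \<noteq> 0}. norm (F X) / norm X)"
      by (intro cSUP_upper2[OF b2, of Z]) auto
    show "(SUP X. norm (F X) / norm X) \<le> (SUP X\<in>{X. X \<noteq> 0}. norm (F X) / norm X)"
    proof (rule cSUP_least)
      fix X :: "'n op"
      show "norm (F X) / norm X \<le> (SUP X\<in>{X. X \<noteq> 0}. norm (F X) / norm X)"
        by (cases "X = 0") (auto intro!: cSUP_upper[OF _ b2] simp: nn)
    qed simp
  qed
  then show ?thesis by (simp add: superop_norm_def onorm_def hs_norm_eq_norm)
qed

lemma hs_inner_ext: "(\<And>Y. hs_inner A Y = hs_inner B Y) \<Longrightarrow> A = B"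
proof -
  assume h: "\<And>Y. hs_inner A Y = hs_inner B Y"
  have "hs_inner (A - B) (A - B) = hs_inner A (A - B) - hs_inner B (A - B)"
    by (simp add: hs_inner_sum sum_subtractf[symmetric] algebra_simps)
  then have "hs_norm (A - B) = 0" using h by (simp add: hs_norm_def hs_inner_def)
  then show ?thesis by (simp add: hs_norm_eq_norm)
qed

lemma hs_adjoint_eqI:
  assumes "\<And>X Y. hs_inner X (F Y) = hs_inner (G X) Y"
  shows "hs_adjoint F = G"
  unfolding hs_adjoint_def
  by (rule the_equality) (use assms in \<open>auto intro!: ext hs_inner_ext\<close>)

lemma dagger_mult: "dagger (A ** B) = dagger B ** dagger A"
  by (simp add: dagger_def matrix_matrix_mult_def vec_eq_iff mult.commute)

lemma dagger_dagger [simp]: "dagger (dagger A) = A"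
  by (simp add: dagger_def vec_eq_iff)

lemma hs_inner_mult_left: "hs_inner X (A ** Y) = hs_inner (dagger A ** X) Y"
  by (simp add: hs_inner_def dagger_mult matrix_mul_assoc)

lemma hs_inner_mult_right: "hs_inner X (Y ** A) = hs_inner (X ** dagger A) Y"
proof -
  have "hs_inner X (Y ** A) = trace ((dagger X ** Y) ** A)"
    by (simp add: hs_inner_def matrix_mul_assoc)
  also have "\<dots> = trace (A ** (dagger X ** Y))" by (rule trace_mul_sym)
  finally show ?thesis by (simp add: hs_inner_def dagger_mult matrix_mul_assoc)
qed

lemma hs_inner_linear:
  "hs_inner X (Y + Z) = hs_inner X Y + hs_inner X Z"
  "hs_inner (X + Y) Z = hs_inner X Z + hs_inner Y Z"
  "hs_inner X (Y - Z) = hs_inner X Y - hs_inner X Z"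
  "hs_inner (X - Y) Z = hs_inner X Z - hs_inner Y Z"
  "hs_inner X (r *\<^sub>R Y) = of_real r * hs_inner X Y"
  "hs_inner (r *\<^sub>R X) Y = of_real r * hs_inner X Y"
  "hs_inner X (cscale c Y) = c * hs_inner X Y"
  "hs_inner (cscale c X) Y = cnj c * hs_inner X Y"
  by (simp_all add: hs_inner_sum cscale_def sum.distrib sum_subtractf sum_distrib_left
      algebra_simps scaleR_conv_of_real[where 'a = complex])

lemma hs_inner_zero [simp]: "hs_inner X 0 = 0" "hs_inner 0 X = 0"
  by (simp_all add: hs_inner_sum)

lemma hs_inner_gksl:
  fixes H :: "('n::finite) op"
  assumes "dagger H = H"
  shows "hs_inner X (gksl H Js Y) = hs_inner (cscale \<i> (H ** X - X ** H)
     + (\<Sum>J\<leftarrow>Js. dagger J ** X ** J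
          - (1 / 2) *\<^sub>R (dagger J ** J ** X + X ** (dagger J ** J)))) Y"
proof -
  have step: "hs_inner X (J ** Y ** dagger J - (1 / 2) *\<^sub>R (dagger J ** J ** Y + Y ** (dagger J ** J)))
      = hs_inner (dagger J ** X ** J - (1 / 2) *\<^sub>R (dagger J ** J ** X + X ** (dagger J ** J))) Y" for J :: "'n op"
  proof -
    have "hs_inner X (J ** Y ** dagger J) = hs_inner (dagger J ** X ** J) Y"
      using hs_inner_mult_right[of X "J ** Y" "dagger J"] hs_inner_mult_left[of "X ** J" J Y]
      by (simp add: matrix_mul_assoc)
    moreover have "hs_inner X (dagger J ** J ** Y) = hs_inner (dagger J ** J ** X) Y"
      using hs_inner_mult_left[of X "dagger J ** J" Y] by (simp add: dagger_mult)
    moreover have "hs_inner X (Y ** (dagger J ** J)) = hs_inner (X ** (dagger J ** J)) Y"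
      using hs_inner_mult_right[of X Y "dagger J ** J"] by (simp add: dagger_mult)
    ultimately show ?thesis by (simp add: hs_inner_linear)
  qed
  have "hs_inner X (\<Sum>J\<leftarrow>Js. J ** Y ** dagger J
          - (1 / 2) *\<^sub>R (dagger J ** J ** Y + Y ** (dagger J ** J)))
      = hs_inner (\<Sum>J\<leftarrow>Js. dagger J ** X ** J
          - (1 / 2) *\<^sub>R (dagger J ** J ** X + X ** (dagger J ** J))) Y"
    by (induction Js) (simp_all only: list.map sum_list.Nil sum_list.Cons hs_inner_zero
        hs_inner_linear(1,2) step)
  moreover have "hs_inner X (H ** Y) = hs_inner (H ** X) Y"
    using hs_inner_mult_left[of X H Y] assms by simp
  moreover have "hs_inner X (Y ** H) = hs_inner (X ** H) Y"
    using hs_inner_mult_right[of X Y H] assms by simp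
  ultimately show ?thesis by (simp add: gksl_def hs_inner_linear)
qed

lemma hs_adjoint_gksl:
  fixes H :: "('n::finite) op"
  assumes "dagger H = H"
  shows "hs_adjoint (gksl H Js) = (\<lambda>X. cscale \<i> (H ** X - X ** H)
     + (\<Sum>J\<leftarrow>Js. dagger J ** X ** J
          - (1 / 2) *\<^sub>R (dagger J ** J ** X + X ** (dagger J ** J))))"
  by (rule hs_adjoint_eqI) (rule hs_inner_gksl[OF assms])

lemma hs_adjoint_local_lindblad:
  assumes "local_lindblad k Le L"
  shows "hs_inner X (L Y) = hs_inner (hs_adjoint L X) Y"
    and "hs_adjoint L = (\<lambda>X. \<Sum>e | card e \<le> k. hs_adjoint (Le e) X)"
proof -
  have each: "hs_inner X (Le e Y) = hs_inner (hs_adjoint (Le e) X) Y" if le: "card e \<le> k" for e X Y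
  proof -
    obtain H Js where H: "dagger H = H" and e: "Le e = gksl H Js"
      using assms le unfolding local_lindblad_def lindblad_on_def by blast
    show ?thesis unfolding e hs_adjoint_gksl[OF H] by (rule hs_inner_gksl[OF H])
  qed
  have sums: "hs_inner X (\<Sum>e\<in>A. f e) = (\<Sum>e\<in>A. hs_inner X (f e))"
    "hs_inner (\<Sum>e\<in>A. f e) X = (\<Sum>e\<in>A. hs_inner (f e) X)" for X and f :: "'a set \<Rightarrow> 'a op" and A
    by (induction A rule: infinite_finite_induct) (simp_all add: hs_inner_linear)
  have all: "hs_inner X (L Y) = hs_inner (\<Sum>e | card e \<le> k. hs_adjoint (Le e) X) Y" for X Y
    using assms by (auto simp: local_lindblad_def sums each intro!: sum.cong)
  show 2: "hs_adjoint L = (\<lambda>X. \<Sum>e | card e \<le> k. hs_adjoint (Le e) X)"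
    by (rule hs_adjoint_eqI) (rule all)
  show "hs_inner X (L Y) = hs_inner (hs_adjoint L X) Y" unfolding 2 by (rule all)
qed

lemma superop_exp_summable:
  fixes F :: "('n::finite) superop"
  assumes "linear F"
  shows "summable (\<lambda>m. (1 / fact m) *\<^sub>R (F ^^ m) X)"
proof -
  have bl: "bounded_linear F" using assms by (simp add: linear_conv_bounded_linear)
  have le: "norm ((F ^^ m) X) \<le> onorm F ^ m * norm X" for m
  proof (induction m)
    case (Suc m)
    have "norm ((F ^^ Suc m) X) \<le> onorm F * norm ((F ^^ m) X)" by (simp add: onorm[OF bl])
    also have "\<dots> \<le> onorm F * (onorm F ^ m * norm X)"
      by (rule mult_left_mono[OF Suc onorm_pos_le[OF bl]])
    finally show ?case by (simp add: mult.assoc)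
  qed simp
  have "summable (\<lambda>m. norm X * (onorm F ^ m /\<^sub>R fact m))"
    by (intro summable_mult summable_exp_generic)
  then show ?thesis
  proof (rule summable_comparison_test')
    fix m :: nat
    show "norm ((1 / fact m) *\<^sub>R (F ^^ m) X) \<le> norm X * (onorm F ^ m /\<^sub>R fact m)"
      using mult_left_mono[OF le[of m], of "1 / fact m"] by (simp add: field_simps)
  qed
qed

end

theory Submission
  imports Defs
begin

text \<open>The adjoint of a local generator annihilates operators supported away from its qubits,
  because these commute with the Hamiltonian and the jump operators. Hence on an operator supported
  on at most \<open>a * k\<close> qubits, \<open>hs_adjoint L\<close> has norm at most \<open>a * k * \<alpha>\<close>, and each application
  enlarges the support by at most \<open>k\<close> qubits. The \<open>m\<close>-th power is therefore bounded by
  \<open>(\<alpha> * k) ^ m\<close> times the rising factorial of \<open>a\<close>, so the \<open>m\<close>-th Taylor term is at most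
  \<open>(1 / 4) ^ m * ((a + m - 1) choose m) \<le> 2 ^ (a - 1) * (1 / 2) ^ m\<close>, and the tail is geometric.\<close>

section \<open>Supported operators, described by bit flips of matrix indices\<close>

definition shift :: "('n \<Rightarrow> bool) \<Rightarrow> ('n \<Rightarrow> bool) \<Rightarrow> 'n \<Rightarrow> bool" where
  "shift z x = (\<lambda>i. x i \<noteq> z i)"

lemma shift_shift [simp]: "shift z (shift z x) = x"
  by (auto simp: shift_def)

lemma bij_shift: "bij (shift z)"
  by (rule o_bij[of "shift z"]) (auto simp: fun_eq_iff)

lemma supported_on_eq_zero:
  assumes "supported_on S A" "i \<notin> S" "x i \<noteq> y i"
  shows "A $ x $ y = 0"
proof -
  have "restrict x (- S) \<noteq> restrict y (- S)"
    using assms(2,3) by (auto simp: restrict_def dest: fun_cong[of _ _ i])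
  then show ?thesis using assms(1) unfolding supported_on_def by auto
qed

lemma supported_on_shift:
  assumes "supported_on S A" "\<forall>i\<in>S. \<not> z i"
  shows "A $ shift z x $ shift z y = A $ x $ y"
proof -
  have "restrict (shift z w) S = restrict w S" for w
    using assms(2) by (auto simp: restrict_def shift_def)
  moreover have "restrict (shift z x) (- S) = restrict (shift z y) (- S)
      \<longleftrightarrow> restrict x (- S) = restrict y (- S)"
    by (auto simp: restrict_def shift_def fun_eq_iff)
  ultimately show ?thesis using assms(1) unfolding supported_on_def by auto
qed

text \<open>Converse of the two lemmas above. Being supported on \<open>S\<close> means commuting
  with every Pauli Z and Pauli X outside \<open>S\<close>: the first condition is diagonality in
  those qubits, the second invariance under flipping them. In this form the closure properties below
  become entrywise checks.\<close>

lemma supported_onI: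
  assumes diag: "\<And>x y i. i \<notin> S \<Longrightarrow> x i \<noteq> y i \<Longrightarrow> A $ x $ y = 0"
    and inv: "\<And>x y z. \<forall>i\<in>S. \<not> z i \<Longrightarrow> A $ shift z x $ shift z y = A $ x $ y"
  shows "supported_on S A"
proof -
  \<comment> \<open>\<open>restrict\<close> puts \<open>undefined\<close> at the positions outside
    \<open>S\<close>; \<open>ext\<close> resets them to \<open>False\<close>, so the witness is the
    block of \<open>A\<close> whose outer bits are all \<open>False\<close>.\<close>
  define ext where "ext w = (\<lambda>i. i \<in> S \<and> w i)" for w :: "'a \<Rightarrow> bool"
  have "A $ x $ y = (if restrict x (- S) = restrict y (- S)
      then A $ ext (restrict x S) $ ext (restrict y S) else 0)" for x y
  proof (cases "restrict x (- S) = restrict y (- S)")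
    case True
    then have off: "x i = y i" if "i \<notin> S" for i
      using that by (metis ComplI restrict_apply')
    \<comment> \<open>This flip clears the outer bits of \<open>x\<close>, and those of
      \<open>y\<close> as well, because the two agree there.\<close>
    define z where "z = (\<lambda>i. i \<notin> S \<and> x i)"
    have "shift z x = ext (restrict x S)" "shift z y = ext (restrict y S)"
      using off by (auto simp: shift_def z_def ext_def)
    moreover have "A $ shift z x $ shift z y = A $ x $ y"
      by (rule inv) (simp add: z_def)
    ultimately show ?thesis using True by simp
  next
    case False
    then obtain i where "i \<notin> S" "x i \<noteq> y i"
      by (auto simp: restrict_def fun_eq_iff split: if_splits)
    then have "A $ x $ y = 0" by (rule diag)
    then show ?thesis using False by simp
  qed
  then show ?thesis
    unfolding supported_on_def
    by (intro exI[of _ "\<lambda>u v. A $ ext u $ ext v"]) blast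
qed

lemma supported_on_mono: "supported_on S A \<Longrightarrow> S \<subseteq> T \<Longrightarrow> supported_on T A"
  by (rule supported_onI) (blast intro: supported_on_eq_zero supported_on_shift)+

lemma supported_on_zero: "supported_on S 0"
  by (rule supported_onI) simp_all

lemma supported_on_add: "supported_on S A \<Longrightarrow> supported_on S B \<Longrightarrow> supported_on S (A + B)"
  by (rule supported_onI) (simp_all add: supported_on_eq_zero supported_on_shift)

lemma supported_on_diff: "supported_on S A \<Longrightarrow> supported_on S B \<Longrightarrow> supported_on S (A - B)"
  by (rule supported_onI) (simp_all add: supported_on_eq_zero supported_on_shift)

lemma supported_on_scaleR: "supported_on S A \<Longrightarrow> supported_on S (r *\<^sub>R A)"
  by (rule supported_onI) (simp_all add: supported_on_eq_zero supported_on_shift)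

lemma supported_on_cscale: "supported_on S A \<Longrightarrow> supported_on S (cscale c A)"
  by (rule supported_onI) (simp_all add: cscale_def supported_on_eq_zero supported_on_shift)

lemma supported_on_dagger: "supported_on S A \<Longrightarrow> supported_on S (dagger A)"
  by (rule supported_onI)
    (simp_all add: dagger_def supported_on_eq_zero[OF _ _ not_sym] supported_on_shift)

lemma supported_on_sum_list:
  "(\<And>x. x \<in> set xs \<Longrightarrow> supported_on S (f x)) \<Longrightarrow> supported_on S (\<Sum>x\<leftarrow>xs. f x)"
  by (induction xs) (simp_all add: supported_on_zero supported_on_add)

lemma supported_on_mult:
  assumes "supported_on S A" "supported_on S B"
  shows "supported_on S (A ** B)"
proof (rule supported_onI)
  fix x y :: "'a \<Rightarrow> bool" and i assume i: "i \<notin> S" "x i \<noteq> y i"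
  have "A $ x $ w * B $ w $ y = 0" for w
  proof (cases "x i = w i")
    case True
    then have "B $ w $ y = 0" using supported_on_eq_zero[OF assms(2) i(1)] i(2) by simp
    then show ?thesis by simp
  next
    case False
    then have "A $ x $ w = 0" by (rule supported_on_eq_zero[OF assms(1) i(1)])
    then show ?thesis by simp
  qed
  then show "(A ** B) $ x $ y = 0" by (simp only: matrix_matrix_mult_def vec_lambda_beta sum.neutral_const)
next
  fix x y z :: "'a \<Rightarrow> bool" assume z: "\<forall>i\<in>S. \<not> z i"
  \<comment> \<open>Flipping permutes the basis, so the intermediate index can be flipped along with
    the outer ones.\<close>
  have "(\<Sum>w\<in>UNIV. A $ shift z x $ w * B $ w $ shift z y)
      = (\<Sum>w\<in>UNIV. A $ shift z x $ shift z w * B $ shift z w $ shift z y)"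
    by (rule sum.reindex_bij_betw[OF bij_shift, symmetric])
  also have "\<dots> = (\<Sum>w\<in>UNIV. A $ x $ w * B $ w $ y)"
    by (simp only: supported_on_shift[OF assms(1) z] supported_on_shift[OF assms(2) z])
  finally show "(A ** B) $ shift z x $ shift z y = (A ** B) $ x $ y"
    by (simp add: matrix_matrix_mult_def)
qed

text \<open>For fixed \<open>x\<close> and \<open>y\<close>, a bijection of the intermediate states
  matches the summands of the two products one by one.\<close>

lemma supported_on_disjoint_commute:
  assumes A: "supported_on S A" and B: "supported_on T B" and "S \<inter> T = {}"
  shows "A ** B = B ** A"
proof -
  have "(\<Sum>w\<in>UNIV. A $ x $ w * B $ w $ y) = (\<Sum>w\<in>UNIV. B $ x $ w * A $ w $ y)" for x y
  proof -
    \<comment> \<open>\<open>s w\<close> is the bitwise exclusive or of \<open>w\<close>,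
      \<open>x\<close> and \<open>y\<close>. If the path from \<open>x\<close> via \<open>w\<close>
      to \<open>y\<close> changes bits in \<open>S\<close> and then bits in \<open>T\<close>, this
      is the state reached by making the changes in \<open>T\<close> first.\<close>
    define s where "s = shift (shift x y)"
    have "A $ x $ w * B $ w $ y = B $ x $ s w * A $ s w $ y" for w
    proof (cases "(\<forall>i. i \<notin> S \<longrightarrow> x i = w i) \<and> (\<forall>i. i \<notin> T \<longrightarrow> w i = y i)")
      case True
      have "\<forall>i\<in>S. \<not> shift w y i" "\<forall>i\<in>T. \<not> shift w x i"
        using True \<open>S \<inter> T = {}\<close> by (auto simp: shift_def)
      then have "A $ x $ w = A $ shift (shift w y) x $ shift (shift w y) w"
          "B $ w $ y = B $ shift (shift w x) w $ shift (shift w x) y"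
        by (simp_all only: supported_on_shift[OF A] supported_on_shift[OF B])
      moreover have "shift (shift w y) x = s w" "shift (shift w y) w = y"
          "shift (shift w x) w = x" "shift (shift w x) y = s w"
        by (auto simp: shift_def s_def)
      ultimately show ?thesis by simp
    next
      case False
      then consider i where "i \<notin> S" "x i \<noteq> w i" | i where "i \<notin> T" "w i \<noteq> y i" by blast
      then show ?thesis
      proof cases
        case 1
        \<comment> \<open>At \<open>i\<close>, \<open>s w\<close> differs from \<open>y\<close>
          exactly when \<open>x\<close> differs from \<open>w\<close>, so both summands
          vanish.\<close>
        then have "s w i \<noteq> y i" by (auto simp: s_def shift_def)
        then have "A $ x $ w = 0" "A $ s w $ y = 0"
          using 1 by (auto intro: supported_on_eq_zero[OF A])
        then show ?thesis by simp
      next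
        case 2
        then have "x i \<noteq> s w i" by (auto simp: s_def shift_def)
        then have "B $ w $ y = 0" "B $ x $ s w = 0"
          using 2 by (auto intro: supported_on_eq_zero[OF B])
        then show ?thesis by simp
      qed
    qed
    then have "(\<Sum>w\<in>UNIV. A $ x $ w * B $ w $ y) = (\<Sum>w\<in>UNIV. B $ x $ s w * A $ s w $ y)"
      by simp
    also have "\<dots> = (\<Sum>w\<in>UNIV. B $ x $ w * A $ w $ y)"
      unfolding s_def by (rule sum.reindex_bij_betw[OF bij_shift])
    finally show ?thesis .
  qed
  then show ?thesis by (simp add: matrix_matrix_mult_def)
qed

section \<open>The adjoint of a single local generator: linearity, norm, support\<close>

lemma linear_matrix_mult_sandwich:
  "linear (\<lambda>X :: ('n::finite) op. A ** X ** B)"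
  by (rule linearI) (simp_all add: matrix_matrix_mult_def vec_eq_iff sum.distrib
      algebra_simps scaleR_sum_right sum_distrib_left)

lemma linear_matrix_mult_left: "linear (\<lambda>X :: ('n::finite) op. A ** X)"
  using linear_matrix_mult_sandwich[of A "mat 1"] by simp

lemma linear_matrix_mult_right: "linear (\<lambda>X :: ('n::finite) op. X ** B)"
  using linear_matrix_mult_sandwich[of "mat 1" B] by simp

lemma linear_cscale: "linear (cscale c)"
  by (rule linearI) (simp_all add: cscale_def vec_eq_iff algebra_simps)

lemma linear_sum_list:
  assumes "\<And>J. J \<in> set Js \<Longrightarrow> linear (f J)"
  shows "linear (\<lambda>X. \<Sum>J\<leftarrow>Js. f J X)"
  using assms
  by (induction Js) (simp_all add: module_hom_zero linear_compose_add)

context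
  fixes e :: "('n::finite) set" and F :: "'n superop"
  assumes F: "lindblad_on e F"
begin

lemma linear_hs_adjoint_lindblad: "linear (hs_adjoint F)"
proof -
  obtain H Js where H: "dagger H = H" and Feq: "F = gksl H Js"
    using F unfolding lindblad_on_def by blast
  have "linear (\<lambda>X. cscale \<i> (H ** X - X ** H))"
    using linear_compose[OF linear_compose_sub[OF linear_matrix_mult_left linear_matrix_mult_right]
        linear_cscale]
    by (simp add: o_def)
  moreover have "linear (\<lambda>X. dagger J ** X ** J
      - (1 / 2) *\<^sub>R (dagger J ** J ** X + X ** (dagger J ** J)))" for J :: "'n op"
    by (intro linear_compose_sub linear_compose_scale_right linear_compose_add
        linear_matrix_mult_sandwich linear_matrix_mult_left linear_matrix_mult_right)
  ultimately show ?thesis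
    unfolding Feq hs_adjoint_gksl[OF H] by (intro linear_compose_add linear_sum_list)
qed

lemma norm_hs_adjoint_lindblad_le: "norm (hs_adjoint F X) \<le> superop_norm (hs_adjoint F) * norm X"
  using onorm[of "hs_adjoint F" X] linear_hs_adjoint_lindblad
  by (simp add: superop_norm_eq_onorm linear_conv_bounded_linear)

lemma superop_norm_hs_adjoint_nonneg: "0 \<le> superop_norm (hs_adjoint F)"
  using onorm_pos_le[of "hs_adjoint F"] linear_hs_adjoint_lindblad
  by (simp add: superop_norm_eq_onorm linear_conv_bounded_linear)

lemma supported_on_hs_adjoint_lindblad:
  assumes "supported_on S A"
  shows "supported_on (S \<union> e) (hs_adjoint F A)"
proof -
  obtain H Js where H: "dagger H = H" "supported_on e H" and Feq: "F = gksl H Js"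
    and Js: "\<forall>J\<in>set Js. supported_on e J"
    using F unfolding lindblad_on_def by blast
  have "supported_on (S \<union> e) A" "supported_on (S \<union> e) H"
    "\<And>J. J \<in> set Js \<Longrightarrow> supported_on (S \<union> e) J"
    using assms H(2) Js supported_on_mono by blast+
  then show ?thesis
    unfolding Feq hs_adjoint_gksl[OF H(1)]
    by (intro supported_on_add supported_on_cscale supported_on_diff supported_on_mult
        supported_on_sum_list supported_on_scaleR supported_on_dagger)
qed

text \<open>Once \<open>A\<close> is moved past the jump operators, the jump term cancels the two
  halves of the anticommutator. This is special to the Heisenberg picture: the dissipator of
  \<open>gksl\<close> itself would leave \<open>A\<close> times the commutator of \<open>J\<close>
  and \<open>dagger J\<close>.\<close>

lemma hs_adjoint_lindblad_disjoint:
  assumes A: "supported_on S A" and disj: "S \<inter> e = {}"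
  shows "hs_adjoint F A = 0"
proof -
  obtain H Js where H: "dagger H = H" "supported_on e H" and Feq: "F = gksl H Js"
    and Js: "\<forall>J\<in>set Js. supported_on e J"
    using F unfolding lindblad_on_def by blast
  have comm: "A ** B = B ** A" if "supported_on e B" for B
    using supported_on_disjoint_commute[OF A that disj] .
  have "dagger J ** A ** J - (1 / 2) *\<^sub>R (dagger J ** J ** A + A ** (dagger J ** J)) = 0"
    if "J \<in> set Js" for J
  proof -
    have J: "supported_on e J" using Js that by blast
    have "dagger J ** A ** J = dagger J ** J ** A"
      using comm[OF J] by (metis matrix_mul_assoc)
    moreover have "A ** (dagger J ** J) = dagger J ** J ** A"
      by (intro comm supported_on_mult supported_on_dagger J)
    ultimately show ?thesis by (simp add: scaleR_2[symmetric])
  qed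
  then have "(\<Sum>J\<leftarrow>Js. dagger J ** A ** J
      - (1 / 2) *\<^sub>R (dagger J ** J ** A + A ** (dagger J ** J))) = (\<Sum>J\<leftarrow>Js. 0)"
    by (intro arg_cong[of _ _ sum_list] map_cong) auto
  then show ?thesis
    unfolding Feq hs_adjoint_gksl[OF H(1)] comm[OF H(2)]
    by (simp add: cscale_def vec_eq_iff)
qed

end

section \<open>The full generator: growth of supports and of iterated norms\<close>

context
  fixes k :: nat and Le :: "('n::finite) set \<Rightarrow> 'n superop" and L :: "'n superop"
  assumes L: "local_lindblad k Le L"
begin

lemma local_lindblad_term: "card e \<le> k \<Longrightarrow> lindblad_on e (Le e)"
  using L unfolding local_lindblad_def by blast

lemma linear_hs_adjoint_local_lindblad: "linear (hs_adjoint L)"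
  unfolding hs_adjoint_local_lindblad(2)[OF L]
  by (intro linear_compose_sum ballI) (auto intro: linear_hs_adjoint_lindblad local_lindblad_term)

lemma sum_superop_norm_le_interaction_strength:
  "(\<Sum>e | card e \<le> k \<and> u \<in> e. superop_norm (hs_adjoint (Le e))) \<le> interaction_strength k Le"
  unfolding interaction_strength_def by (rule Max_ge) auto

lemma interaction_strength_nonneg: "0 \<le> interaction_strength k Le"
proof -
  have "0 \<le> (\<Sum>e | card e \<le> k \<and> u \<in> e. superop_norm (hs_adjoint (Le e)))" for u
    by (rule sum_nonneg) (auto intro: superop_norm_hs_adjoint_nonneg local_lindblad_term)
  then show ?thesis using sum_superop_norm_le_interaction_strength order_trans by blast
qed

text \<open>A union bound: a set \<open>e\<close> meeting \<open>S\<close> is counted once for each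
  qubit they share, hence at least once. Exchanging the sums leaves at most the interaction strength
  per qubit of \<open>S\<close>.\<close>

lemma sum_superop_norm_intersecting_le:
  "(\<Sum>e | card e \<le> k \<and> S \<inter> e \<noteq> {}. superop_norm (hs_adjoint (Le e)))
     \<le> card S * interaction_strength k Le"
proof -
  let ?w = "\<lambda>e. superop_norm (hs_adjoint (Le e))"
  have w: "0 \<le> ?w e" if "card e \<le> k" for e
    by (rule superop_norm_hs_adjoint_nonneg[OF local_lindblad_term[OF that]])
  have "(\<Sum>e | card e \<le> k \<and> S \<inter> e \<noteq> {}. ?w e)
      \<le> (\<Sum>e | card e \<le> k \<and> S \<inter> e \<noteq> {}. \<Sum>u | u \<in> S \<and> u \<in> e. ?w e)"
  proof (rule sum_mono)
    fix e assume e: "e \<in> {e. card e \<le> k \<and> S \<inter> e \<noteq> {}}"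
    then have "{u. u \<in> S \<and> u \<in> e} \<noteq> {}" by blast
    then have "1 \<le> card {u. u \<in> S \<and> u \<in> e}" by (simp add: Suc_le_eq card_gt_0_iff)
    then have "1 * ?w e \<le> real (card {u. u \<in> S \<and> u \<in> e}) * ?w e"
      using w[of e] e by (intro mult_right_mono) auto
    then show "?w e \<le> (\<Sum>u | u \<in> S \<and> u \<in> e. ?w e)" by simp
  qed
  also have "\<dots> \<le> (\<Sum>e | card e \<le> k. \<Sum>u | u \<in> S \<and> u \<in> e. ?w e)"
    by (rule sum_mono2) (auto intro: mult_nonneg_nonneg w)
  also have "\<dots> = (\<Sum>u\<in>S. \<Sum>e | card e \<le> k \<and> u \<in> e. ?w e)"
    using sum.swap_restrict[of S "{e. card e \<le> k}" "\<lambda>u e. ?w e" "\<lambda>u e. u \<in> e"] by simp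
  also have "\<dots> \<le> (\<Sum>u\<in>S. interaction_strength k Le)"
    by (rule sum_mono) (rule sum_superop_norm_le_interaction_strength)
  finally show ?thesis by simp
qed

text \<open>The induction peels off the innermost application: each \<open>Le e\<close> meeting \<open>S\<close> enlarges the
  support to \<open>S \<union> e\<close>, so that \<open>a\<close> is replaced by \<open>a + 1\<close>.\<close>

lemma norm_hs_adjoint_funpow_le:
  assumes "supported_on S A" "card S \<le> a * k"
  shows "norm ((hs_adjoint L ^^ m) A)
    \<le> (interaction_strength k Le * k) ^ m * pochhammer (real a) m * norm A"
  using assms
proof (induction m arbitrary: S A a)
  case (Suc m)
  let ?\<alpha> = "interaction_strength k Le"
  let ?E = "{e. card e \<le> k \<and> S \<inter> e \<noteq> {}}"
  \<comment> \<open>The factor from the induction hypothesis at \<open>a + 1\<close>; multiplying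
    the shifted rising factorial by \<open>a\<close> gives the one of length \<open>Suc m\<close>
    starting at \<open>a\<close>.\<close>
  let ?c = "(?\<alpha> * k) ^ m * pochhammer (real a + 1) m"
  have c: "0 \<le> ?c"
    by (simp add: interaction_strength_nonneg pochhammer_nonneg)
  have lin: "linear (hs_adjoint L ^^ m)" for m
    using linear_hs_adjoint_local_lindblad
    by (induction m) (simp_all add: linear_compose module_hom_ident id_def[symmetric] linear_id)
  have "hs_adjoint L A = (\<Sum>e\<in>?E. hs_adjoint (Le e) A)"
    unfolding hs_adjoint_local_lindblad(2)[OF L]
    using hs_adjoint_lindblad_disjoint[OF local_lindblad_term Suc.prems(1)]
    by (intro sum.mono_neutral_right) auto
  then have "norm ((hs_adjoint L ^^ Suc m) A)
      = norm (\<Sum>e\<in>?E. (hs_adjoint L ^^ m) (hs_adjoint (Le e) A))"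
    by (simp only: funpow_Suc_right o_apply linear_sum[OF lin])
  also have "\<dots> \<le> (\<Sum>e\<in>?E. norm ((hs_adjoint L ^^ m) (hs_adjoint (Le e) A)))"
    by (rule norm_sum)
  also have "\<dots> \<le> (\<Sum>e\<in>?E. ?c * (superop_norm (hs_adjoint (Le e)) * norm A))"
  proof (rule sum_mono)
    fix e assume "e \<in> ?E"
    then have e: "card e \<le> k" by blast
    have "card (S \<union> e) \<le> (a + 1) * k"
      using card_Un_le[of S e] e Suc.prems(2) by simp
    from Suc.IH[OF supported_on_hs_adjoint_lindblad[OF local_lindblad_term[OF e] Suc.prems(1)] this]
    have "norm ((hs_adjoint L ^^ m) (hs_adjoint (Le e) A)) \<le> ?c * norm (hs_adjoint (Le e) A)"
      by (simp add: add.commute)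
    also have "\<dots> \<le> ?c * (superop_norm (hs_adjoint (Le e)) * norm A)"
      by (intro mult_left_mono norm_hs_adjoint_lindblad_le[OF local_lindblad_term[OF e]] c)
    finally show "norm ((hs_adjoint L ^^ m) (hs_adjoint (Le e) A))
        \<le> ?c * (superop_norm (hs_adjoint (Le e)) * norm A)" .
  qed
  also have "\<dots> = (?c * norm A) * (\<Sum>e\<in>?E. superop_norm (hs_adjoint (Le e)))"
    by (simp add: sum_distrib_left mult_ac)
  \<comment> \<open>Of this factor, \<open>k * ?\<alpha>\<close> raises the power by one and
    \<open>a\<close> completes the rising factorial.\<close>
  also have "\<dots> \<le> (?c * norm A) * (real (a * k) * ?\<alpha>)"
  proof (rule mult_left_mono)
    have "(\<Sum>e\<in>?E. superop_norm (hs_adjoint (Le e))) \<le> card S * ?\<alpha>"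
      by (rule sum_superop_norm_intersecting_le)
    also have "\<dots> \<le> real (a * k) * ?\<alpha>"
      using Suc.prems(2) by (intro mult_right_mono interaction_strength_nonneg of_nat_mono)
    finally show "(\<Sum>e\<in>?E. superop_norm (hs_adjoint (Le e))) \<le> real (a * k) * ?\<alpha>" .
  qed (simp add: c)
  also have "\<dots> = (?\<alpha> * k) ^ Suc m * pochhammer (real a) (Suc m) * norm A"
    by (simp add: pochhammer_rec mult_ac)
  finally show ?case .
qed simp

end

section \<open>Taylor remainder and truncation degree\<close>

lemma pochhammer_div_fact_le:
  assumes "1 \<le> a"
  shows "pochhammer (real a) m / fact m \<le> 2 ^ (a + m - 1)"
proof -
  \<comment> \<open>As \<open>a\<close> is positive, the natural subtraction is exact. Bounding the
    coefficient by its whole row of Pascal's triangle costs a factor \<open>2 ^ m\<close>, which the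
    short time absorbs later.\<close>
  have "pochhammer (real a) m / fact m = real ((a + m - 1) choose m)"
    using assms by (simp add: binomial_gbinomial gbinomial_pochhammer' of_nat_diff)
  also have "\<dots> \<le> 2 ^ (a + m - 1)"
    by (metis binomial_le_pow2 of_nat_le_iff of_nat_numeral of_nat_power)
  finally show ?thesis .
qed

lemma superop_exp_minus_taylor_op:
  fixes F :: "('n::finite) superop"
  assumes "linear F"
  shows "superop_exp (\<lambda>X. t *\<^sub>R F X) Q - taylor_op F Q d t
      = (\<Sum>m. (t ^ (m + Suc d) / fact (m + Suc d)) *\<^sub>R (F ^^ (m + Suc d)) Q)"
proof -
  have pow: "((\<lambda>X. t *\<^sub>R F X) ^^ m) Q = t ^ m *\<^sub>R (F ^^ m) Q" for m
    by (induction m) (simp_all add: linear_scale[OF assms])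
  have "linear (\<lambda>X. t *\<^sub>R F X)" by (rule linear_compose_scale_right[OF assms])
  from superop_exp_summable[OF this, of Q]
  have s: "summable (\<lambda>m. (t ^ m / fact m) *\<^sub>R (F ^^ m) Q)" by (simp add: pow)
  then show ?thesis
    \<comment> \<open>The Taylor polynomial includes index \<open>d\<close>, so \<open>Suc d\<close>
      terms are removed.\<close>
    using suminf_minus_initial_segment[OF s, of "Suc d"]
    by (simp add: superop_exp_def taylor_op_def pow lessThan_Suc_atMost)
qed

text \<open>The principal filter makes the bound uniform over all admissible pairs. The constant 2
  covers both losses: \<open>ln 2\<close> is at least 1/2, and the 1 from the ceiling is absorbed by
  \<open>a\<close>.\<close>

lemma truncation_degree_bigo:
  "(\<lambda>(a, \<epsilon>). real (truncation_degree a \<epsilon>))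
     \<in> O[principal {(a, \<epsilon>). 1 \<le> a \<and> 0 < \<epsilon> \<and> \<epsilon> < 1}](\<lambda>(a, \<epsilon>). real a + ln (1 / \<epsilon>))"
proof (rule landau_o.bigI[of 2])
  have "real (truncation_degree a \<epsilon>) \<le> 2 * \<bar>real a + ln (1 / \<epsilon>)\<bar>"
    if "1 \<le> a" "0 < \<epsilon>" "\<epsilon> < 1" for a \<epsilon>
  proof -
    have ln: "0 < ln (1 / \<epsilon>)" using that by simp
    have "1 / 2 \<le> ln (2 :: real)" using ln2_ge_two_thirds by simp
    then have "log 2 (1 / \<epsilon>) \<le> 2 * ln (1 / \<epsilon>)"
      using mult_left_mono[of "1 / 2" "ln 2" "ln (1 / \<epsilon>)"] ln
      unfolding log_def by (simp add: divide_le_eq mult_ac)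
    moreover have "0 \<le> log 2 (1 / \<epsilon>)" using that by simp
    then have "real (nat \<lceil>log 2 (1 / \<epsilon>)\<rceil>) \<le> log 2 (1 / \<epsilon>) + 1" by linarith
    ultimately have "real (nat \<lceil>log 2 (1 / \<epsilon>)\<rceil>) \<le> 2 * ln (1 / \<epsilon>) + 1" by linarith
    then have "real (truncation_degree a \<epsilon>) \<le> 2 * (real a + ln (1 / \<epsilon>))"
      using of_nat_mono[OF that(1), where 'a = real] unfolding truncation_degree_def by simp
    then show ?thesis by (rule order_trans) (intro mult_left_mono abs_ge_self, simp)
  qed
  then show "\<forall>\<^sub>F x in principal {(a, \<epsilon>). 1 \<le> a \<and> 0 < \<epsilon> \<and> \<epsilon> < 1}.
      norm (case x of (a, \<epsilon>) \<Rightarrow> real (truncation_degree a \<epsilon>))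
        \<le> 2 * norm (case x of (a, \<epsilon>) \<Rightarrow> real a + ln (1 / \<epsilon>))"
    by (auto simp: eventually_principal)
qed simp

theorem lemma4p1:
  fixes Le :: "('n::finite) set \<Rightarrow> 'n superop" and L :: "'n superop" and Q :: "'n op"
    and k q a d :: nat and \<alpha> \<epsilon> t :: real
  assumes "k \<ge> 1"
    and "local_lindblad k Le L"
    and "\<alpha> = interaction_strength k Le"
    and "q \<noteq> 0"
    and "local_op q Q"
    and "a = nat \<lceil>real q / real k\<rceil>"
    and "0 < \<epsilon>" and "\<epsilon> < 1"
    and "0 \<le> t" and "\<alpha> \<noteq> 0 \<Longrightarrow> t \<le> 1 / (4 * \<alpha> * real k)"
    and "d = truncation_degree a \<epsilon>"
  shows "hs_norm (superop_exp (\<lambda>X. t *\<^sub>R hs_adjoint L X) Q - taylor_op (hs_adjoint L) Q d t)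
           \<le> \<epsilon> * hs_norm Q
       \<and> (\<lambda>(a, \<epsilon>). real (truncation_degree a \<epsilon>))
           \<in> O[principal {(a, \<epsilon>). 1 \<le> a \<and> 0 < \<epsilon> \<and> \<epsilon> < 1}](\<lambda>(a, \<epsilon>). real a + ln (1 / \<epsilon>))"
proof (rule conjI)
  let ?D = "hs_adjoint L"
  note lin = linear_hs_adjoint_local_lindblad[OF assms(2)]
  obtain S where S: "card S \<le> q" "supported_on S Q"
    using assms(5) unfolding local_op_def by blast
  have "real q / real k \<le> real a" using assms(6) by linarith
  then have "real q \<le> real (a * k)" using assms(1) by (simp add: divide_le_eq)
  then have "card S \<le> a * k" using S(1) by linarith
  note bound = norm_hs_adjoint_funpow_le[OF assms(2) S(2) this, folded assms(3)]
  have a: "1 \<le> a" using \<open>real q \<le> real (a * k)\<close> assms(4) by (cases a) auto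
  have \<alpha>: "0 \<le> \<alpha>" using interaction_strength_nonneg[OF assms(2)] assms(3) by simp
  have t\<alpha>k: "t * (\<alpha> * k) \<le> 1 / 4"
  \<comment> \<open>For \<open>\<alpha> = 0\<close> the time is unbounded above, but the product is
    0.\<close>
  proof (cases "\<alpha> = 0")
    case False
    then have "t \<le> 1 / (4 * \<alpha> * k)" "0 < 4 * \<alpha> * k" using assms(1,10) \<alpha> by auto
    then show ?thesis by (simp add: pos_le_divide_eq mult_ac)
  qed simp
  have le: "norm ((t ^ m / fact m) *\<^sub>R (?D ^^ m) Q) \<le> 2 ^ (a - 1) * (1 / 2) ^ m * norm Q" for m
  proof -
    have "norm ((t ^ m / fact m) *\<^sub>R (?D ^^ m) Q)
        \<le> (t ^ m / fact m) * ((\<alpha> * k) ^ m * pochhammer (real a) m * norm Q)"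
      using assms(9) by (simp add: mult_left_mono[OF bound] divide_right_mono)
    also have "\<dots> = (t * (\<alpha> * k)) ^ m * (pochhammer (real a) m / fact m) * norm Q"
      by (simp add: power_mult_distrib)
    also have "\<dots> \<le> (1 / 4) ^ m * 2 ^ (a + m - 1) * norm Q"
      using assms(9) \<alpha> t\<alpha>k
      by (intro mult_right_mono mult_mono power_mono pochhammer_div_fact_le a)
        (auto intro!: divide_nonneg_pos pochhammer_nonneg simp: less_le_trans[OF zero_less_one a])
    also have "(1 / 4) ^ m * (2 :: real) ^ (a + m - 1) = 2 ^ (a - 1) * ((1 / 4) ^ m * 2 ^ m)"
      using a by (simp flip: power_add)
    also have "(1 / 4) ^ m * (2 :: real) ^ m = (1 / 2) ^ m"
      by (simp flip: power_mult_distrib)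
    finally show ?thesis .
  qed
  let ?f = "\<lambda>m. (t ^ (m + Suc d) / fact (m + Suc d)) *\<^sub>R (?D ^^ (m + Suc d)) Q"
  \<comment> \<open>The term bound at index \<open>Suc d\<close>, where the tail starts; summing the
    ratio 1/2 doubles it, which restores the exponent \<open>d\<close>.\<close>
  let ?C = "2 ^ (a - 1) * (1 / 2) ^ Suc d * norm Q"
  have geo: "(\<lambda>m. ?C * (1 / 2) ^ m) sums (?C * 2)"
    using sums_mult[OF geometric_sums[of "1 / 2 :: real"], of ?C] by simp
  have "norm (?f m) \<le> ?C * (1 / 2) ^ m" for m
    using le[of "m + Suc d"] by (simp add: power_add mult_ac)
  then have "norm (suminf ?f) \<le> (\<Sum>m. ?C * (1 / 2) ^ m)"
    by (intro norm_suminf_le sums_summable[OF geo])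
  also have "\<dots> = ?C * 2" using geo by (rule sums_unique[symmetric])
  also have "\<dots> = 2 ^ (a - 1) * (1 / 2) ^ d * norm Q" by simp
  also have "\<dots> \<le> \<epsilon> * norm Q"
  proof (rule mult_right_mono)
    define l where "l = nat \<lceil>log 2 (1 / \<epsilon>)\<rceil>"
    have "log 2 (1 / \<epsilon>) \<le> real l" unfolding l_def by linarith
    then have "1 / \<epsilon> \<le> 2 ^ l"
      using assms(7) by (simp add: log_le_iff powr_realpow)
    then have l: "(1 / 2) ^ l \<le> \<epsilon>"
      using assms(7) by (simp add: power_one_over divide_le_eq mult_ac)
    \<comment> \<open>The summand \<open>a\<close> of the degree cancels the prefactor
      \<open>2 ^ (a - 1)\<close>; the logarithmic summand \<open>l\<close> supplies
      \<open>\<epsilon>\<close>.\<close>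
    have "(2 :: real) ^ (a - 1) * (1 / 2) ^ d = (2 ^ (a - 1) * (1 / 2) ^ a) * (1 / 2) ^ l"
      by (simp add: assms(11) truncation_degree_def l_def power_add)
    also have "(2 :: real) ^ (a - 1) * (1 / 2) ^ a \<le> 1"
      by (simp add: power_one_over)
    finally show "(2 :: real) ^ (a - 1) * (1 / 2) ^ d \<le> \<epsilon>"
      using l by simp
  qed simp
  finally show "hs_norm (superop_exp (\<lambda>X. t *\<^sub>R ?D X) Q - taylor_op ?D Q d t) \<le> \<epsilon> * hs_norm Q"
    unfolding hs_norm_eq_norm superop_exp_minus_taylor_op[OF lin] .
qed (rule truncation_degree_bigo)

end
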